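(* An identity $u=v$ in one binary operation symbol $\lhd$ is satisfied by $\mathrm{Core}(G)$ for all abelian groups $G$ if and only if it is a consequence of the defining identities of involutory quandles, namely $$x\lhd x=x,\qquad x\lhd(x\lhd y)=y,\qquad (x\lhd y)\lhd z=x\lhd(y\lhd(x\lhd z)),$$ together with the identity $$w\lhd(x\lhd(y\lhd z))\ =\ y\lhd(x\lhd(w\lhd z)).$$
   Context: For a group $G$, $\mathrm{Core}(G)$ is the underlying set of $G$ with the binary operation $x\lhd y=xy^{-1}x$. An identity is an equation $u=v$ between two words $u,v$ formed from variables with the operation symbol $\lhd$; it is satisfied by a structure if it holds for all values of the variables. An identity is a consequence of a set of identities if it holds in every set with a binary operation $\lhd$ satisfying all identities of that set. *)

theory Defs
  imports "HOL-Algebra.Group"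
begin

datatype word =
    Var nat
  | Tri word word  (infixr "\<triangleleft>" 70)

type_synonym identity = "word \<times> word"

primrec eval :: "('a \<Rightarrow> 'a \<Rightarrow> 'a) \<Rightarrow> (nat \<Rightarrow> 'a) \<Rightarrow> word \<Rightarrow> 'a" where
  "eval f \<rho> (Var n) = \<rho> n"
| "eval f \<rho> (s \<triangleleft> t) = f (eval f \<rho> s) (eval f \<rho> t)"

text \<open>A set with a binary operation is given by a carrier \<open>A\<close> (possibly empty) together with a
  function \<open>f\<close> under which \<open>A\<close> is closed; values of \<open>f\<close> outside \<open>A\<close> are irrelevant.\<close>

definition closed_under :: "'a set \<Rightarrow> ('a \<Rightarrow> 'a \<Rightarrow> 'a) \<Rightarrow> bool" where
  "closed_under A f \<longleftrightarrow> (\<forall>a\<in>A. \<forall>b\<in>A. f a b \<in> A)"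

definition satisfies :: "'a set \<Rightarrow> ('a \<Rightarrow> 'a \<Rightarrow> 'a) \<Rightarrow> identity \<Rightarrow> bool" where
  "satisfies A f e \<longleftrightarrow> (\<forall>\<rho>. (\<forall>n. \<rho> n \<in> A) \<longrightarrow> eval f \<rho> (fst e) = eval f \<rho> (snd e))"

text \<open>HOL cannot quantify over all types inside a formula, so the structures range over all
  subsets of a type \<open>'a\<close>, which is passed as an argument. Results about this notion should be
  stated for arbitrary infinite \<open>'a\<close>: every set with a binary operation is isomorphic to one
  whose carrier is a subset of some infinite type.\<close>

definition consequence :: "'a itself \<Rightarrow> identity set \<Rightarrow> identity \<Rightarrow> bool" where
  "consequence (_ :: 'a itself) E e \<longleftrightarrow>
     (\<forall>(A :: 'a set) f. closed_under A f \<longrightarrow> (\<forall>d\<in>E. satisfies A f d) \<longrightarrow> satisfies A f e)"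

definition core_op :: "('g, 'm) monoid_scheme \<Rightarrow> 'g \<Rightarrow> 'g \<Rightarrow> 'g" where
  "core_op G x y = x \<otimes>\<^bsub>G\<^esub> inv\<^bsub>G\<^esub> y \<otimes>\<^bsub>G\<^esub> x"

definition involutory_quandle_identities :: "identity set" where
  "involutory_quandle_identities =
     (let x = Var 0; y = Var 1; z = Var 2 in
       {(x \<triangleleft> x, x),
        (x \<triangleleft> (x \<triangleleft> y), y),
        ((x \<triangleleft> y) \<triangleleft> z, x \<triangleleft> (y \<triangleleft> (x \<triangleleft> z)))})"

definition abelian_core_identity :: identity where
  "abelian_core_identity =
     (let x = Var 0; y = Var 1; z = Var 2; w = Var 3 in
       (w \<triangleleft> (x \<triangleleft> (y \<triangleleft> z)), y \<triangleleft> (x \<triangleleft> (w \<triangleleft> z))))"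

end

theory Submission
  imports Defs "HOL-Library.Nat_Bijection"
begin

text \<open>Self-distributivity \<open>(x \<triangleleft> y) \<triangleleft> z = x \<triangleleft> (y \<triangleleft> (x \<triangleleft> z))\<close> rewrites every word as
  \<open>x\<^sub>1 \<triangleleft> (x\<^sub>2 \<triangleleft> \<dots> (x\<^sub>n \<triangleleft> z))\<close> with variables \<open>x\<^sub>i\<close> and \<open>z\<close>, and idempotence allows \<open>n\<close> to be taken
  even. In an abelian group its value is \<open>2 (x\<^sub>1 - x\<^sub>2 + \<dots> - x\<^sub>n) + z\<close>. If two words agree
  in \<open>\<int>\<close>, comparing coefficients modulo 2 shows that they end in the same \<open>z\<close>, so the alternating
  sums agree as well. The identity for \<open>w\<close>, \<open>x\<close>, \<open>y\<close>, \<open>z\<close> permutes the \<open>x\<^sub>i\<close> in positions of equal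
  parity, after which equal variables in positions of opposite parity cancel by involutivity; hence
  a sequence with alternating sum zero acts trivially. So the identities of \<open>Core(\<int>)\<close> hold in every
  model of the axioms, and \<open>\<int>\<close> embeds into every infinite type.\<close>

section \<open>Models of the axioms\<close>

locale abelian_core =
  fixes A :: "'a set" and f :: "'a \<Rightarrow> 'a \<Rightarrow> 'a"
  assumes closed: "x \<in> A \<Longrightarrow> y \<in> A \<Longrightarrow> f x y \<in> A"
    and idem: "x \<in> A \<Longrightarrow> f x x = x"
    and invol: "x \<in> A \<Longrightarrow> y \<in> A \<Longrightarrow> f x (f x y) = y"
    and dist: "x \<in> A \<Longrightarrow> y \<in> A \<Longrightarrow> z \<in> A \<Longrightarrow> f (f x y) z = f x (f y (f x z))"
    and swap: "w \<in> A \<Longrightarrow> x \<in> A \<Longrightarrow> y \<in> A \<Longrightarrow> z \<in> A \<Longrightarrow> f w (f x (f y z)) = f y (f x (f w z))"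

lemma abelian_core_iff:
  "abelian_core A f \<longleftrightarrow> closed_under A f \<and>
    (\<forall>d\<in>insert abelian_core_identity involutory_quandle_identities. satisfies A f d)"
  (is "?L \<longleftrightarrow> ?R")
proof
  assume ?L
  then interpret abelian_core A f .
  show ?R
    by (simp add: closed_under_def satisfies_def abelian_core_identity_def
        involutory_quandle_identities_def Let_def closed idem invol dist)
      (blast intro: swap)
next
  assume R: ?R
  \<comment> \<open>Variables beyond 3 occur in no axiom; they also get \<open>w\<close>, which
    keeps the valuation inside \<open>A\<close>.\<close>
  have sat: "eval f (\<lambda>n. if n = 0 then x else if n = 1 then y else if n = 2 then z else w) (fst d) =
      eval f (\<lambda>n. if n = 0 then x else if n = 1 then y else if n = 2 then z else w) (snd d)"
    (is "eval f ?\<rho> _ = _")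
    if "x \<in> A" "y \<in> A" "z \<in> A" "w \<in> A"
      "d \<in> insert abelian_core_identity involutory_quandle_identities" for x y z w d
  proof -
    have "satisfies A f d" using R that(5) by blast
    moreover have "\<forall>n. ?\<rho> n \<in> A" using that by simp
    ultimately show ?thesis
      unfolding satisfies_def by (rule mp[OF spec[of _ ?\<rho>]])
  qed
  note defs = abelian_core_identity_def involutory_quandle_identities_def Let_def
  show ?L
  proof
    show "f x y \<in> A" if "x \<in> A" "y \<in> A" for x y
      using R that by (simp add: closed_under_def)
    show "f x x = x" if "x \<in> A" for x
      using sat[of x x x x "(Var 0 \<triangleleft> Var 0, Var 0)"] that by (simp add: defs)
    show "f x (f x y) = y" if "x \<in> A" "y \<in> A" for x y
      using sat[of x y x x "(Var 0 \<triangleleft> (Var 0 \<triangleleft> Var 1), Var 1)"] that by (simp add: defs)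
    show "f (f x y) z = f x (f y (f x z))" if "x \<in> A" "y \<in> A" "z \<in> A" for x y z
      using sat[of x y z x "((Var 0 \<triangleleft> Var 1) \<triangleleft> Var 2, Var 0 \<triangleleft> (Var 1 \<triangleleft> (Var 0 \<triangleleft> Var 2)))"] that
      by (simp add: defs)
    show "f w (f x (f y z)) = f y (f x (f w z))" if "w \<in> A" "x \<in> A" "y \<in> A" "z \<in> A" for w x y z
      using sat[of x y z w abelian_core_identity] that by (simp add: defs)
  qed
qed

lemma abelian_core_int: "abelian_core UNIV (\<lambda>x y. 2 * x - y :: int)"
  by unfold_locales (auto simp: algebra_simps)

lemma (in comm_group) abelian_core_core_op: "abelian_core (carrier G) (core_op G)"
proof -
  have op: "core_op G x y = (x \<otimes> x) \<otimes> inv y" if "x \<in> carrier G" "y \<in> carrier G" for x y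
    using that by (simp add: core_op_def m_ac)
  have cancel: "a \<otimes> (inv a \<otimes> b) = b" "inv a \<otimes> (a \<otimes> b) = b"
    if "a \<in> carrier G" "b \<in> carrier G" for a b
    using that by (simp_all flip: m_assoc)
  show ?thesis
    by unfold_locales (simp_all add: op inv_mult m_ac cancel)
qed

section \<open>Words as sequences of variables\<close>

definition act :: "('a \<Rightarrow> 'a \<Rightarrow> 'a) \<Rightarrow> (nat \<Rightarrow> 'a) \<Rightarrow> nat list \<Rightarrow> 'a \<Rightarrow> 'a" where
  "act f \<rho> l = foldr (\<lambda>n. f (\<rho> n)) l"

lemma act_simps [simp]:
  "act f \<rho> [] z = z"
  "act f \<rho> (n # l) z = f (\<rho> n) (act f \<rho> l z)"
  "act f \<rho> (l @ m) z = act f \<rho> l (act f \<rho> m z)"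
  by (simp_all add: act_def)

primrec last_var :: "word \<Rightarrow> nat" where
  "last_var (Var n) = n"
| "last_var (s \<triangleleft> t) = last_var t"

text \<open>The palindrome around \<open>last_var s\<close> encodes left multiplication by
  \<open>s\<close>: by \<open>dist\<close> it is left multiplication by \<open>last_var s\<close>,
  conjugated by the prefix of \<open>s\<close>, and reversal inverts a product of
  involutions.\<close>

primrec prefix_vars :: "word \<Rightarrow> nat list" where
  "prefix_vars (Var n) = []"
| "prefix_vars (s \<triangleleft> t) = prefix_vars s @ last_var s # rev (prefix_vars s) @ prefix_vars t"

text \<open>A prefix of length \<open>n\<close> gives the last variable the sign
  \<open>(-1) ^ n\<close> in an abelian group; even length fixes it to be positive.\<close>

definition even_prefix :: "word \<Rightarrow> nat list" where
  "even_prefix t =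
     (if even (length (prefix_vars t)) then prefix_vars t else prefix_vars t @ [last_var t])"

lemma even_length_even_prefix: "even (length (even_prefix t))"
  by (simp add: even_prefix_def)

definition alt_sum :: "nat \<Rightarrow> nat list \<Rightarrow> int" where
  "alt_sum i l = foldr (\<lambda>n c. of_bool (n = i) - c) l 0"

lemma alt_sum_simps [simp]:
  "alt_sum i [] = 0"
  "alt_sum i (n # l) = of_bool (n = i) - alt_sum i l"
  by (simp_all add: alt_sum_def)

text \<open>Reversing a nonempty \<open>l\<close> multiplies its alternating sum by
  \<open>(-1) ^ (length l - 1)\<close>, while \<open>m\<close> is shifted by \<open>length l\<close>
  positions.\<close>

lemma alt_sum_rev_append:
  "alt_sum i (rev l @ m) = (-1) ^ length l * (alt_sum i m - alt_sum i l)"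
  by (induction l arbitrary: m) (auto simp: right_diff_distrib)

text \<open>In \<open>Core(Z)\<close> a word is an integer linear form in its variables; its value
  at the \<open>i\<close>-th unit vector is the coefficient of variable \<open>i\<close>.\<close>

definition coefficient :: "word \<Rightarrow> nat \<Rightarrow> int" where
  "coefficient t i = eval (\<lambda>x y. 2 * x - y) (\<lambda>n. of_bool (n = i)) t"

section \<open>Sequences acting on a model\<close>

context abelian_core
begin

context
  fixes \<rho> :: "nat \<Rightarrow> 'a"
  assumes valuation: "\<rho> n \<in> A"
begin

lemma act_closed: "z \<in> A \<Longrightarrow> act f \<rho> l z \<in> A"
  by (induction l) (auto intro: closed valuation)

lemma op_act: "x \<in> A \<Longrightarrow> z \<in> A \<Longrightarrow> f (act f \<rho> l x) z = act f \<rho> l (f x (act f \<rho> (rev l) z))"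
  by (induction l arbitrary: z) (simp_all add: dist closed valuation act_closed)

lemma act_act_rev: "z \<in> A \<Longrightarrow> act f \<rho> l (act f \<rho> (rev l) z) = z"
  by (induction l arbitrary: z) (simp_all add: invol closed valuation)

lemma eval_eq_act: "eval f \<rho> t = act f \<rho> (even_prefix t) (\<rho> (last_var t))"
proof -
  have "eval f \<rho> t = act f \<rho> (prefix_vars t) (\<rho> (last_var t))"
    by (induction t) (simp_all add: op_act valuation act_closed)
  then show ?thesis
    by (simp add: even_prefix_def idem valuation)
qed

text \<open>A positive alternating sum forces \<open>i\<close> into some position of positive sign,
  and \<open>swap\<close> exchanges entries two places apart, so \<open>i\<close> can travel to the
  front.\<close>

lemma act_move_front:
  assumes "0 < alt_sum i l"
  obtains l' where "length l = Suc (length l')" "\<And>j. alt_sum j (i # l') = alt_sum j l"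
    "\<And>z. z \<in> A \<Longrightarrow> act f \<rho> (i # l') z = act f \<rho> l z"
proof -
  have "\<exists>l'. length l = Suc (length l') \<and> (\<forall>j. alt_sum j (i # l') = alt_sum j l) \<and>
      (\<forall>z\<in>A. act f \<rho> (i # l') z = act f \<rho> l z)"
    using assms
  proof (induction l rule: induct_list012)
    case (3 a b l)
    show ?case
    proof (cases "a = i")
      case True
      then show ?thesis by (intro exI[of _ "b # l"]) simp
    next
      case False
      \<comment> \<open>The entry \<open>a\<close> contributes nothing and \<open>b\<close> at most
        -1, so the positive part comes from \<open>l\<close>.\<close>
      then have "0 < alt_sum i l"
        using 3(3) by (simp split: if_splits add: of_bool_def)
      then obtain l' where l': "length l = Suc (length l')"
        "\<And>j. alt_sum j (i # l') = alt_sum j l"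
        "\<And>z. z \<in> A \<Longrightarrow> act f \<rho> (i # l') z = act f \<rho> l z"
        using 3(1) by blast
      have "alt_sum j (i # b # a # l') = alt_sum j (a # b # l)" for j
        using l'(2)[of j] by simp
      moreover have "act f \<rho> (i # b # a # l') z = act f \<rho> (a # b # l) z" if "z \<in> A" for z
        using l'(3)[OF that] swap[of "\<rho> i" "\<rho> b" "\<rho> a" "act f \<rho> l' z"]
        by (simp add: valuation act_closed that)
      ultimately show ?thesis
        using l'(1) by (intro exI[of _ "b # a # l'"]) simp
    qed
  qed (auto simp: of_bool_def split: if_splits)
  then show ?thesis
    using that by blast
qed

lemma act_trivial: "(\<And>i. alt_sum i l = 0) \<Longrightarrow> z \<in> A \<Longrightarrow> act f \<rho> l z = z"
proof (induction "length l" arbitrary: l rule: less_induct)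
  case less
  show ?case
  proof (cases l)
    case (Cons i t)
    \<comment> \<open>The head contributes 1 to a vanishing sum, so this value is 1. Once
      \<open>i\<close> leads the tail as well, the two copies cancel by
      \<open>invol\<close>.\<close>
    have "0 < alt_sum i t"
      using less.prems(1)[of i] by (simp add: Cons)
    then obtain t' where t': "length t = Suc (length t')"
      "\<And>j. alt_sum j (i # t') = alt_sum j t"
      "\<And>z. z \<in> A \<Longrightarrow> act f \<rho> (i # t') z = act f \<rho> t z"
      by (rule act_move_front) blast
    have "alt_sum j t' = 0" for j
      using less.prems(1)[of j] t'(2)[of j] by (simp add: Cons)
    then have "act f \<rho> t' z = z"
      using less t'(1) by (simp add: Cons)
    then show ?thesis
      using less.prems(2) by (simp add: Cons invol valuation flip: t'(3))
  qed simp
qed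

lemma act_eqI:
  assumes "even (length l)" "\<And>i. alt_sum i l = alt_sum i m" "z \<in> A"
  shows "act f \<rho> l z = act f \<rho> m z"
proof -
  \<comment> \<open>Acting by \<open>rev l\<close> inverts acting by \<open>l\<close>, and the
    alternating sums of \<open>rev l @ m\<close> are, up to sign, the differences of those of
    \<open>m\<close> and \<open>l\<close>.\<close>
  have "act f \<rho> (rev l @ m) z = z"
    using assms by (intro act_trivial) (simp_all add: alt_sum_rev_append)
  then show ?thesis
    using act_act_rev[OF act_closed[OF assms(3)], of l m] by simp
qed

end

end

section \<open>Coefficients determine the identities\<close>

lemma coefficient_eq:
  "coefficient t i = 2 * alt_sum i (even_prefix t) + of_bool (last_var t = i)"
proof -
  have "act (\<lambda>x y. 2 * x - y) (\<lambda>n. of_bool (n = i)) l z =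
      2 * alt_sum i l + (-1) ^ length l * (z :: int)" for l z
    by (induction l) auto
  then show ?thesis
    by (simp add: coefficient_def abelian_core.eval_eq_act[OF abelian_core_int]
        even_length_even_prefix)
qed

lemma (in abelian_core) satisfies_if_coefficient_eq:
  assumes "coefficient u = coefficient v"
  shows "satisfies A f (u, v)"
proof -
  have eq: "2 * alt_sum i (even_prefix u) + of_bool (last_var u = i) =
      2 * alt_sum i (even_prefix v) + of_bool (last_var v = i)" for i
    using assms by (metis coefficient_eq)
  \<comment> \<open>Otherwise \<open>eq\<close> at \<open>last_var v\<close> equates an even number
    with an odd one.\<close>
  have "last_var u = last_var v"
    using eq[of "last_var v"] by (cases "last_var u = last_var v"; simp; presburger)
  then show ?thesis
    using eq act_eqI[OF _ even_length_even_prefix, of _ u "even_prefix v"]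
    by (simp add: satisfies_def eval_eq_act)
qed

text \<open>The group is a copy of the integers, transported along an injection into
  \<open>'b\<close>; valuations by its 0 and 1 recover every coefficient.\<close>

lemma comm_group_detecting_coefficients:
  assumes "infinite (UNIV :: 'b set)"
  obtains G :: "'b monoid" where "comm_group G"
    "\<And>u v. satisfies (carrier G) (core_op G) (u, v) \<Longrightarrow> coefficient u = coefficient v"
proof -
  obtain g :: "nat \<Rightarrow> 'b" where "inj g"
    using infinite_countable_subset[OF assms] by blast
  define h :: "int \<Rightarrow> 'b" where "h = g \<circ> int_encode"
  have "inj h"
    unfolding h_def using \<open>inj g\<close> inj_int_encode by (rule inj_compose)
  then have inv_h [simp]: "inv_into UNIV h (h x) = x" and h_eq [simp]: "h x = h y \<longleftrightarrow> x = y" for x y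
    by (auto simp: inj_eq)
  define G :: "'b monoid" where
    "G = \<lparr>carrier = range h, mult = (\<lambda>x y. h (inv_into UNIV h x + inv_into UNIV h y)), one = h 0\<rparr>"
  have [simp]: "carrier G = range h" "h x \<otimes>\<^bsub>G\<^esub> h y = h (x + y)" "\<one>\<^bsub>G\<^esub> = h 0" for x y
    by (simp_all add: G_def)
  interpret comm_group G
  proof (rule comm_groupI)
    fix x assume "x \<in> carrier G"
    then obtain k where "x = h k" by auto
    then show "\<exists>y\<in>carrier G. y \<otimes>\<^bsub>G\<^esub> x = \<one>\<^bsub>G\<^esub>"
      by (intro bexI[of _ "h (- k)"]) auto
  qed (auto simp: algebra_simps)
  have [simp]: "inv\<^bsub>G\<^esub> h x = h (- x)" for x
    by (rule inv_equality) auto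
  have eval_h: "eval (core_op G) (\<lambda>n. h (\<rho> n)) t = h (eval (\<lambda>x y. 2 * x - y) \<rho> t)" for \<rho> t
    by (induction t) (simp_all add: core_op_def)
  show ?thesis
  proof
    show "comm_group G" by (rule comm_group_axioms)
    show "coefficient u = coefficient v" if "satisfies (carrier G) (core_op G) (u, v)" for u v
    proof
      fix i
      have "eval (core_op G) (\<lambda>n. h (of_bool (n = i))) u =
          eval (core_op G) (\<lambda>n. h (of_bool (n = i))) v"
        using that by (simp add: satisfies_def)
      then show "coefficient u i = coefficient v i"
        by (simp add: eval_h coefficient_def)
    qed
  qed
qed

theorem theorem7p1:
  fixes u v :: word
  assumes "infinite (UNIV :: 'g set)" and "infinite (UNIV :: 'a set)"
  shows "(\<forall>G :: 'g monoid. comm_group G \<longrightarrow> satisfies (carrier G) (core_op G) (u, v)) \<longleftrightarrow>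
         consequence TYPE('a) (insert abelian_core_identity involutory_quandle_identities) (u, v)"
  (is "?L \<longleftrightarrow> ?R")
proof
  assume ?L
  obtain G :: "'g monoid" where "comm_group G"
    "satisfies (carrier G) (core_op G) (u, v) \<Longrightarrow> coefficient u = coefficient v"
    using comm_group_detecting_coefficients[OF assms(1)] by metis
  then have "coefficient u = coefficient v"
    using \<open>?L\<close> by blast
  then show ?R
    unfolding consequence_def
    by (metis abelian_core_iff abelian_core.satisfies_if_coefficient_eq)
next
  \<comment> \<open>The groups in \<open>?L\<close> live in \<open>'g\<close>, the models in
    \<open>?R\<close> in \<open>'a\<close>. The copy of the integers inside \<open>'a\<close> yields
    equal coefficients, a condition free of either type, and this passes to all cores over
    \<open>'g\<close>.\<close>
  assume ?R
  obtain G :: "'a monoid" where G: "comm_group G"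
    "satisfies (carrier G) (core_op G) (u, v) \<Longrightarrow> coefficient u = coefficient v"
    using comm_group_detecting_coefficients[OF assms(2)] by metis
  have "satisfies (carrier G) (core_op G) (u, v)"
    using \<open>?R\<close> comm_group.abelian_core_core_op[OF G(1)]
    unfolding consequence_def abelian_core_iff by blast
  then have "coefficient u = coefficient v"
    by (rule G(2))
  then show ?L
    by (blast intro: abelian_core.satisfies_if_coefficient_eq comm_group.abelian_core_core_op)
qed

end
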